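(* Let $p\in[1,\infty)$ and let $\gamma_S$ be a finite Borel measure on $S$ with $\gamma_S(S)>0$ that is strictly positive (every nonempty relatively open subset of $S$ has positive $\gamma_S$-measure). Then $SW_p^\gamma$ is a metric on $\mathcal P_p(X)$: it is finite, symmetric, satisfies the triangle inequality, and $SW_p^\gamma(\mu,\nu)=0$ if and only if $\mu=\nu$.
   Context: $X$ is an infinite-dimensional separable real Hilbert space with inner product $\langle\cdot,\cdot\rangle$ and norm $\|\cdot\|$; $S=\{x\in X:\|x\|=1\}$ with the relative norm topology. $\mathcal P_p(X)$ is the set of Borel probability measures on $X$ with $\int_X\|x\|^p\,d\mu<\infty$. For $\theta\in S$, $P_\theta(x)=\langle\theta,x\rangle$ and $\hat\mu_\theta:=P_\theta\#\mu$. $W_p$ is the $p$-Wasserstein distance on probability measures on $\mathbb R$. The $p$-sliced Wasserstein distance with respect to $\gamma_S$ is $$SW_p^\gamma(\mu,\nu)=\Big(\frac{1}{\gamma_S(S)}\int_S W_p^p(\hat\mu_\theta,\hat\nu_\theta)\,\gamma_S(d\theta)\Big)^{1/p}.$$ (An example of such $\gamma_S$ is the surface measure on $S$ associated with a non-degenerate centered Gaussian measure on $X$.) *)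

theory Defs
  imports "HOL-Probability.Probability"
begin

definition unit_sphere :: "'a::real_normed_vector set" where
  "unit_sphere = sphere 0 1"

definition Pp :: "real \<Rightarrow> 'a::real_normed_vector measure set" where
  "Pp p = {\<mu>. sets \<mu> = sets borel \<and> prob_space \<mu> \<and>
                (\<integral>\<^sup>+ x. ennreal (norm x powr p) \<partial>\<mu>) < \<infinity>}"

definition proj_measure :: "'a::real_inner measure \<Rightarrow> 'a \<Rightarrow> real measure" where
  "proj_measure \<mu> \<theta> = distr \<mu> borel (\<lambda>x. inner \<theta> x)"

definition couplings :: "real measure \<Rightarrow> real measure \<Rightarrow> (real \<times> real) measure set" where
  "couplings \<mu> \<nu> = {\<pi>. sets \<pi> = sets (borel :: (real \<times> real) measure) \<and> prob_space \<pi> \<and>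
                        distr \<pi> borel fst = \<mu> \<and> distr \<pi> borel snd = \<nu>}"

definition Wpp :: "real \<Rightarrow> real measure \<Rightarrow> real measure \<Rightarrow> ennreal" where
  "Wpp p \<mu> \<nu> = (INF \<pi>\<in>couplings \<mu> \<nu>. \<integral>\<^sup>+ z. ennreal (\<bar>fst z - snd z\<bar> powr p) \<partial>\<pi>)"

text \<open>(SW_p^gamma)^p, valued in [0,\<infinity>]; gamma is a measure on the sphere.\<close>
definition SWpp :: "real \<Rightarrow> 'a::real_inner measure \<Rightarrow> 'a measure \<Rightarrow> 'a measure \<Rightarrow> ennreal" where
  "SWpp p \<gamma> \<mu> \<nu> = (\<integral>\<^sup>+ \<theta>. Wpp p (proj_measure \<mu> \<theta>) (proj_measure \<nu> \<theta>) \<partial>\<gamma>)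
                      / emeasure \<gamma> unit_sphere"

text \<open>SW_p^gamma itself (meaningful as a real number once SWpp is finite).\<close>
definition SW :: "real \<Rightarrow> 'a::real_inner measure \<Rightarrow> 'a measure \<Rightarrow> 'a measure \<Rightarrow> real" where
  "SW p \<gamma> \<mu> \<nu> = enn2real (SWpp p \<gamma> \<mu> \<nu>) powr (1 / p)"

end

theory Submission
  imports Defs
begin

text \<open>The projected distance \<open>\<theta> \<mapsto> W\<^sub>p(\<mu>\<^sub>\<theta>, \<nu>\<^sub>\<theta>)\<close> is Lipschitz, because \<open>x \<mapsto> (\<langle>\<theta>, x\<rangle>, \<langle>\<theta>', x\<rangle>)\<close>
  couples two projections of the same measure; it is finite, because all projections along
  \<open>\<theta> = 0\<close> are the Dirac mass at 0. Hence it is measurable, and the triangle inequality for \<open>W\<^sub>p\<close> on the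
  line passes to \<open>SW\<close> by Minkowski's inequality. If \<open>SW\<close> vanishes, then by continuity and strict
  positivity of \<open>\<gamma>\<close> every projected distance vanishes, so that \<open>\<mu>\<close> and \<open>\<nu>\<close> have the same characteristic
  function and are equal by the Cramer-Wold theorem.\<close>

section \<open>Minkowski and gluing\<close>

text \<open>Convexity of \<open>x powr p\<close> at the points \<open>u / a\<close> and
  \<open>v / b\<close> with weights \<open>a / (a + b)\<close> and \<open>b / (a + b)\<close>. The
  coefficients are arranged so that replacing \<open>u powr p\<close> by \<open>a powr p\<close> and
  \<open>v powr p\<close> by \<open>b powr p\<close> yields exactly
  \<open>(a + b) powr p\<close>.\<close>

lemma powr_add_le_weighted:
  fixes p a b u v :: real
  assumes p: "1 \<le> p" and "0 < a" "0 < b" "0 \<le> u" "0 \<le> v"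
  shows "(u + v) powr p \<le>
    (a + b) powr p * (a / (a + b) / a powr p) * u powr p +
    (a + b) powr p * (b / (a + b) / b powr p) * v powr p"
proof -
  define s t where "s = a / (a + b)" and "t = b / (a + b)"
  have st: "0 < s" "0 < t" "s + t = 1" "s \<le> 1" "t \<le> 1"
    using assms by (auto simp: s_def t_def simp flip: add_divide_distrib)
  have s_eq: "1 - t = s" using st by linarith
  \<comment> \<open>Covers convexity when one of the two points is 0, where it reduces to
    \<open>r powr p \<le> r\<close> on the unit interval.\<close>
  have shrink: "(r * x) powr p \<le> r * x powr p" if "0 \<le> r" "r \<le> 1" "0 \<le> x" for r x :: real
  proof (cases "r = 0")
    case False
    have "r powr p \<le> r powr 1"
      using that p False by (intro powr_mono') auto
    with that False show ?thesis
      by (auto simp: powr_mult intro!: mult_right_mono)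
  qed simp
  have conv: "(s * x + t * y) powr p \<le> s * x powr p + t * y powr p" if "0 \<le> x" "0 \<le> y" for x y
  proof (cases "x = 0 \<or> y = 0")
    case True
    then show ?thesis using shrink[of s x] shrink[of t y] st that by auto
  next
    case False
    then show ?thesis
      using convex_onD[OF powr_convex[OF p], of t x y] that st s_eq by simp
  qed
  have "u + v = (a + b) * (s * (u / a) + t * (v / b))"
  proof -
    have "(a + b) * (s * (u / a) + t * (v / b)) = ((a + b) * s) * (u / a) + ((a + b) * t) * (v / b)"
      by (simp only: distrib_left mult.assoc)
    also have "\<dots> = u + v" using assms by (simp add: s_def t_def)
    finally show ?thesis by simp
  qed
  then have "(u + v) powr p = (a + b) powr p * (s * (u / a) + t * (v / b)) powr p"
    using assms st by (simp add: powr_mult)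
  also have "\<dots> \<le> (a + b) powr p * (s * (u / a) powr p + t * (v / b) powr p)"
    using assms by (intro mult_left_mono conv) auto
  also have "\<dots> = (a + b) powr p * (s / a powr p) * u powr p + (a + b) powr p * (t / b powr p) * v powr p"
    using assms by (simp add: powr_divide algebra_simps)
  finally show ?thesis by (simp add: s_def t_def)
qed

text \<open>Integrate the weighted convexity inequality pointwise. Working with positive upper
  bounds \<open>a\<close>, \<open>b\<close> instead of the norms themselves avoids roots of
  integrals and division by 0; vanishing norms are reached later through an arbitrarily small
  slack.\<close>

lemma Minkowski_nn_integral:
  fixes f g h :: "'b \<Rightarrow> real"
  assumes p: "1 \<le> p" and a: "0 < a" and b: "0 < b"
    and [measurable]: "f \<in> borel_measurable M" "g \<in> borel_measurable M"
    and AE: "AE x in M. 0 \<le> f x \<and> 0 \<le> g x \<and> 0 \<le> h x \<and> h x \<le> f x + g x"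
    and f: "(\<integral>\<^sup>+x. ennreal (f x powr p) \<partial>M) \<le> ennreal (a powr p)"
    and g: "(\<integral>\<^sup>+x. ennreal (g x powr p) \<partial>M) \<le> ennreal (b powr p)"
  shows "(\<integral>\<^sup>+x. ennreal (h x powr p) \<partial>M) \<le> ennreal ((a + b) powr p)"
proof -
  define A B where "A = (a + b) powr p * (a / (a + b) / a powr p)"
    and "B = (a + b) powr p * (b / (a + b) / b powr p)"
  have AB: "0 \<le> A" "0 \<le> B" using a b by (auto simp: A_def B_def)
  have "(\<integral>\<^sup>+x. ennreal (h x powr p) \<partial>M) \<le>
      (\<integral>\<^sup>+x. ennreal A * ennreal (f x powr p) + ennreal B * ennreal (g x powr p) \<partial>M)"
  proof (rule nn_integral_mono_AE, use AE in eventually_elim)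
    case (elim x)
    then have "h x powr p \<le> (f x + g x) powr p"
      using p by (intro powr_mono2) auto
    also have "\<dots> \<le> A * f x powr p + B * g x powr p"
      unfolding A_def B_def using elim by (intro powr_add_le_weighted p a b) auto
    finally show ?case using AB
      by (simp flip: ennreal_mult ennreal_plus add: ennreal_leI)
  qed
  also have "\<dots> = ennreal A * (\<integral>\<^sup>+x. ennreal (f x powr p) \<partial>M) + ennreal B * (\<integral>\<^sup>+x. ennreal (g x powr p) \<partial>M)"
    by (subst nn_integral_add) (auto simp: nn_integral_cmult)
  also have "\<dots> \<le> ennreal A * ennreal (a powr p) + ennreal B * ennreal (b powr p)"
    using f g by (intro add_mono mult_left_mono) auto
  also have "\<dots> = ennreal (A * a powr p + B * b powr p)"
    using AB by (simp flip: ennreal_mult ennreal_plus)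
  also have "A * a powr p + B * b powr p = (a + b) powr p"
    using a b by (simp add: A_def B_def flip: distrib_left add_divide_distrib)
  finally show ?thesis .
qed

section \<open>Gluing two couplings along their common marginal\<close>

lemma couplingsD:
  assumes "\<pi> \<in> couplings \<mu> \<nu>"
  shows "sets \<pi> = sets (borel \<Otimes>\<^sub>M borel)" "prob_space \<pi>" "distr \<pi> borel fst = \<mu>" "distr \<pi> borel snd = \<nu>"
  using assms unfolding couplings_def borel_prod by blast+

text \<open>Since only the infimum over couplings matters, an approximate gluing suffices: condition
  both couplings on the cell of the middle coordinate in a countable partition of the line, and
  make them independent given the cell. No disintegration is needed.\<close>

lemma approximate_gluing:
  assumes \<pi>: "\<pi> \<in> couplings \<mu> \<nu>" and \<sigma>: "\<sigma> \<in> couplings \<nu> \<rho>" and e: "0 < e"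
  obtains G :: "((real \<times> real) \<times> (real \<times> real)) measure"
  where "sets G = sets ((borel \<Otimes>\<^sub>M borel) \<Otimes>\<^sub>M (borel \<Otimes>\<^sub>M borel))" "prob_space G"
    "distr G (borel \<Otimes>\<^sub>M borel) fst = \<pi>" "distr G (borel \<Otimes>\<^sub>M borel) snd = \<sigma>"
    "AE w in G. \<bar>snd (fst w) - fst (snd w)\<bar> \<le> e"
proof -
  note [measurable_cong] = couplingsD(1)[OF \<pi>] couplingsD(1)[OF \<sigma>]
  interpret \<pi>: prob_space \<pi> by (rule couplingsD[OF \<pi>])
  interpret \<sigma>: prob_space \<sigma> by (rule couplingsD[OF \<sigma>])
  interpret P: pair_prob_space \<pi> \<sigma> ..
  \<comment> \<open>Cells have length \<open>e\<close>, so two points of one cell are less than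
    \<open>e\<close> apart.\<close>
  define cell :: "real \<Rightarrow> int" where "cell y = \<lfloor>y / e\<rfloor>" for y
  define m where "m k = emeasure \<nu> (cell -` {k})" for k
  have cell_m[measurable]: "cell \<in> borel \<rightarrow>\<^sub>M count_space UNIV"
    unfolding cell_def by measurable
  have cell_s[measurable]: "cell -` {k} \<in> sets borel" for k
    using measurable_sets[OF cell_m, of "{k}"] by simp
  have m_\<pi>: "m k = emeasure \<pi> {z \<in> space \<pi>. cell (snd z) = k}" for k
    unfolding m_def couplingsD(4)[OF \<pi>, symmetric]
    by (subst emeasure_distr) (auto intro!: arg_cong2[where f=emeasure] simp: vimage_def)
  have m_\<sigma>: "m k = emeasure \<sigma> {z \<in> space \<sigma>. cell (fst z) = k}" for k
    unfolding m_def couplingsD(3)[OF \<sigma>, symmetric]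
    by (subst emeasure_distr) (auto intro!: arg_cong2[where f=emeasure] simp: vimage_def)
  have m_fin: "m k < \<infinity>" for k
    unfolding m_\<pi> using \<pi>.emeasure_finite by (simp add: less_top[symmetric])
  \<comment> \<open>The density of the glued measure with respect to the product: pairs with
    different cells get weight 0, and division by the mass of the cell restores the marginals. On a
    cell of mass 0 the value is infinite, so such cells must be shown negligible.\<close>
  define h :: "(real \<times> real) \<times> (real \<times> real) \<Rightarrow> ennreal"
    where "h w = indicator {w. cell (snd (fst w)) = cell (fst (snd w))} w / m (cell (snd (fst w)))" for w
  have [measurable]: "h \<in> borel_measurable (\<pi> \<Otimes>\<^sub>M \<sigma>)"
    unfolding h_def by measurable
  have mass: "m k * (1 / m k) = 1" if "m k \<noteq> 0" for k
    using that m_fin[of k] by (simp add: ennreal_divide_times ennreal_times_divide)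
  \<comment> \<open>There are only countably many cells, so the null ones together form a null
    set.\<close>
  have AE\<pi>: "AE z in \<pi>. m (cell (snd z)) \<noteq> 0"
  proof -
    have "AE z in \<pi>. \<forall>k. m k = 0 \<longrightarrow> cell (snd z) \<noteq> k"
      unfolding AE_all_countable
    proof (intro allI)
      fix k
      show "AE z in \<pi>. m k = 0 \<longrightarrow> cell (snd z) \<noteq> k"
        by (cases "m k = 0") (auto simp: m_\<pi> intro!: AE_I[of _ _ "{z \<in> space \<pi>. cell (snd z) = k}"])
    qed
    then show ?thesis by eventually_elim auto
  qed
  have AE\<sigma>: "AE z in \<sigma>. m (cell (fst z)) \<noteq> 0"
  proof -
    have "AE z in \<sigma>. \<forall>k. m k = 0 \<longrightarrow> cell (fst z) \<noteq> k"
      unfolding AE_all_countable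
    proof (intro allI)
      fix k
      show "AE z in \<sigma>. m k = 0 \<longrightarrow> cell (fst z) \<noteq> k"
        by (cases "m k = 0") (auto simp: m_\<sigma> intro!: AE_I[of _ _ "{z \<in> space \<sigma>. cell (fst z) = k}"])
    qed
    then show ?thesis by eventually_elim auto
  qed
  define G where "G = density (\<pi> \<Otimes>\<^sub>M \<sigma>) h"
  have sG: "sets G = sets ((borel \<Otimes>\<^sub>M borel) \<Otimes>\<^sub>M (borel \<Otimes>\<^sub>M borel))"
    unfolding G_def sets_density by (intro sets_pair_measure_cong couplingsD[OF \<pi>] couplingsD[OF \<sigma>])
  note [measurable_cong] = sG
  \<comment> \<open>The section of \<open>h\<close> is the constant \<open>1 / m k\<close> on a cell
    of mass \<open>m k\<close>. That both partial integrals are 1 is what makes \<open>\<pi>\<close>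
    and \<open>\<sigma>\<close> the marginals of \<open>G\<close>.\<close>
  have inner1: "(\<integral>\<^sup>+z'. h (z, z') \<partial>\<sigma>) = 1" if "m (cell (snd z)) \<noteq> 0" for z
  proof -
    have "(\<integral>\<^sup>+z'. h (z, z') \<partial>\<sigma>) = (\<integral>\<^sup>+z'. (1 / m (cell (snd z))) * indicator {z' \<in> space \<sigma>. cell (fst z') = cell (snd z)} z' \<partial>\<sigma>)"
      by (intro nn_integral_cong) (auto simp: h_def split: split_indicator)
    also have "\<dots> = 1"
      using mass[OF that] by (subst nn_integral_cmult_indicator) (auto simp: m_\<sigma>[symmetric] mult.commute)
    finally show ?thesis .
  qed
  have inner2: "(\<integral>\<^sup>+z. h (z, z') \<partial>\<pi>) = 1" if "m (cell (fst z')) \<noteq> 0" for z'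
  proof -
    have "(\<integral>\<^sup>+z. h (z, z') \<partial>\<pi>) = (\<integral>\<^sup>+z. (1 / m (cell (fst z'))) * indicator {z \<in> space \<pi>. cell (snd z) = cell (fst z')} z \<partial>\<pi>)"
      by (intro nn_integral_cong) (auto simp: h_def split: split_indicator)
    also have "\<dots> = 1"
      using mass[OF that] by (subst nn_integral_cmult_indicator) (auto simp: m_\<pi>[symmetric] mult.commute)
    finally show ?thesis .
  qed
  have d1: "distr G (borel \<Otimes>\<^sub>M borel) fst = \<pi>"
  proof (rule measure_eqI)
    fix A assume "A \<in> sets (distr G (borel \<Otimes>\<^sub>M borel) fst)"
    then have [measurable]: "A \<in> sets (borel \<Otimes>\<^sub>M borel)" by simp
    have "emeasure (distr G (borel \<Otimes>\<^sub>M borel) fst) A = (\<integral>\<^sup>+w. indicator A (fst w) \<partial>G)"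
      by (subst nn_integral_distr[symmetric, where f="indicator A" and T=fst and M=G and M'="borel \<Otimes>\<^sub>M borel"]) auto
    also have "\<dots> = (\<integral>\<^sup>+w. h w * indicator A (fst w) \<partial>(\<pi> \<Otimes>\<^sub>M \<sigma>))"
      unfolding G_def by (subst nn_integral_density) auto
    also have "\<dots> = (\<integral>\<^sup>+z. (\<integral>\<^sup>+z'. h (z, z') \<partial>\<sigma>) * indicator A z \<partial>\<pi>)"
      by (subst \<sigma>.nn_integral_fst[symmetric]) (auto intro!: nn_integral_cong nn_integral_multc)
    also have "\<dots> = (\<integral>\<^sup>+z. indicator A z \<partial>\<pi>)"
      by (rule nn_integral_cong_AE, use AE\<pi> in eventually_elim) (simp add: inner1)
    also have "\<dots> = emeasure \<pi> A" by simp
    finally show "emeasure (distr G (borel \<Otimes>\<^sub>M borel) fst) A = emeasure \<pi> A" .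
  qed (simp add: couplingsD[OF \<pi>])
  have d2: "distr G (borel \<Otimes>\<^sub>M borel) snd = \<sigma>"
  proof (rule measure_eqI)
    fix A assume "A \<in> sets (distr G (borel \<Otimes>\<^sub>M borel) snd)"
    then have [measurable]: "A \<in> sets (borel \<Otimes>\<^sub>M borel)" by simp
    have "emeasure (distr G (borel \<Otimes>\<^sub>M borel) snd) A = (\<integral>\<^sup>+w. indicator A (snd w) \<partial>G)"
      by (subst nn_integral_distr[symmetric, where f="indicator A" and T=snd and M=G and M'="borel \<Otimes>\<^sub>M borel"]) auto
    also have "\<dots> = (\<integral>\<^sup>+w. h w * indicator A (snd w) \<partial>(\<pi> \<Otimes>\<^sub>M \<sigma>))"
      unfolding G_def by (subst nn_integral_density) auto
    also have "\<dots> = (\<integral>\<^sup>+z'. (\<integral>\<^sup>+z. h (z, z') \<partial>\<pi>) * indicator A z' \<partial>\<sigma>)"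
      by (subst P.nn_integral_snd[symmetric]) (auto intro!: nn_integral_cong nn_integral_multc)
    also have "\<dots> = (\<integral>\<^sup>+z. indicator A z \<partial>\<sigma>)"
      by (rule nn_integral_cong_AE, use AE\<sigma> in eventually_elim) (simp add: inner2)
    also have "\<dots> = emeasure \<sigma> A" by simp
    finally show "emeasure (distr G (borel \<Otimes>\<^sub>M borel) snd) A = emeasure \<sigma> A" .
  qed (simp add: couplingsD[OF \<sigma>])
  have "prob_space (distr G (borel \<Otimes>\<^sub>M borel) fst)"
    unfolding d1 by (rule couplingsD[OF \<pi>])
  then have "prob_space G" by (rule prob_space_distrD[rotated]) simp
  moreover have "AE w in G. \<bar>snd (fst w) - fst (snd w)\<bar> \<le> e"
    unfolding G_def
  proof (subst AE_density, simp, intro AE_I2 impI)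
    fix w assume "0 < h w"
    then have "\<lfloor>snd (fst w) / e\<rfloor> = \<lfloor>fst (snd w) / e\<rfloor>"
      by (auto simp: h_def cell_def split: split_indicator_asm)
    then have "\<bar>snd (fst w) / e - fst (snd w) / e\<bar> < 1" by linarith
    then have "\<bar>snd (fst w) - fst (snd w)\<bar> / e < 1"
      using e by (simp flip: diff_divide_distrib add: abs_divide)
    with e show "\<bar>snd (fst w) - fst (snd w)\<bar> \<le> e" by (simp add: field_simps)
  qed
  ultimately show thesis using that sG d1 d2 by blast
qed

section \<open>The Wasserstein distance on the line\<close>

lemma Wpp_le:
  assumes "\<pi> \<in> couplings \<mu> \<nu>"
  shows "Wpp p \<mu> \<nu> \<le> (\<integral>\<^sup>+z. ennreal (\<bar>fst z - snd z\<bar> powr p) \<partial>\<pi>)"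
  unfolding Wpp_def using assms by (rule INF_lower)

lemma Wpp_lessE:
  assumes "Wpp p \<mu> \<nu> < c"
  obtains \<pi> where "\<pi> \<in> couplings \<mu> \<nu>" "(\<integral>\<^sup>+z. ennreal (\<bar>fst z - snd z\<bar> powr p) \<partial>\<pi>) < c"
  using assms unfolding Wpp_def INF_less_iff by blast

lemma distr_mem_couplings:
  assumes "prob_space M" and [measurable]: "f \<in> borel_measurable M" "g \<in> borel_measurable M"
  shows "distr M (borel \<Otimes>\<^sub>M borel) (\<lambda>x. (f x, g x)) \<in> couplings (distr M borel f) (distr M borel g)"
proof -
  interpret prob_space M by fact
  show ?thesis
    by (auto simp: couplings_def borel_prod[symmetric] distr_distr comp_def intro!: prob_space_distr)
qed

text \<open>Two random variables on one probability space couple their laws. This serves both for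
  the glued measure and for two projections of the same measure.\<close>

lemma Wpp_distr_le:
  assumes "prob_space M" and [measurable]: "f \<in> borel_measurable M" "g \<in> borel_measurable M"
  shows "Wpp p (distr M borel f) (distr M borel g) \<le> (\<integral>\<^sup>+x. ennreal (\<bar>f x - g x\<bar> powr p) \<partial>M)"
  using Wpp_le[OF distr_mem_couplings[OF assms], of p] by (simp add: nn_integral_distr)

lemma couplings_swap:
  assumes "\<pi> \<in> couplings \<mu> \<nu>"
  shows "distr \<pi> (borel \<Otimes>\<^sub>M borel) (\<lambda>z. (snd z, fst z)) \<in> couplings \<nu> \<mu>"
proof -
  note c = couplingsD[OF assms]
  note [measurable_cong] = c(1)
  from distr_mem_couplings[OF c(2), of snd fst] show ?thesis
    by (simp add: c)
qed

lemma Wpp_le_swap: "Wpp p \<nu> \<mu> \<le> Wpp p \<mu> \<nu>"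
  unfolding Wpp_def[of p \<mu>]
proof (rule INF_greatest)
  fix \<pi> assume \<pi>: "\<pi> \<in> couplings \<mu> \<nu>"
  note [measurable_cong] = couplingsD(1)[OF \<pi>]
  show "Wpp p \<nu> \<mu> \<le> (\<integral>\<^sup>+z. ennreal (\<bar>fst z - snd z\<bar> powr p) \<partial>\<pi>)"
    using Wpp_le[OF couplings_swap[OF \<pi>], of p] by (simp add: nn_integral_distr abs_minus_commute)
qed

lemma Wpp_commute: "Wpp p \<mu> \<nu> = Wpp p \<nu> \<mu>"
  by (intro antisym Wpp_le_swap)

section \<open>The triangle inequality for the Wasserstein distance on the line\<close>

lemma ennreal_le_powr_limI:
  fixes x :: ennreal and c p :: real
  assumes "0 \<le> c" and le: "\<And>e. 0 < e \<Longrightarrow> x \<le> ennreal ((c + e) powr p)" and p: "1 \<le> p"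
  shows "x \<le> ennreal (c powr p)"
proof (rule tendsto_lowerbound)
  have "((\<lambda>e. (c + e) powr p) \<longlongrightarrow> (c + 0) powr p) (at_right 0)"
    using assms by (intro tendsto_powr' tendsto_intros) (auto simp: eventually_at_filter)
  then show "((\<lambda>e. ennreal ((c + e) powr p)) \<longlongrightarrow> ennreal (c powr p)) (at_right 0)"
    by (intro tendsto_ennrealI) simp
  show "\<forall>\<^sub>F e in at_right 0. x \<le> ennreal ((c + e) powr p)"
    using le by (auto simp: eventually_at_filter)
qed simp

text \<open>Glue nearly optimal couplings so that the two middle coordinates differ by at most
  \<open>e\<close>. Minkowski's inequality, applied twice with the constant \<open>e\<close> as a
  third summand, gives the bound \<open>a + b + e\<close>, and \<open>e\<close> tends to 0. Strict
  hypotheses supply actual couplings below the bounds.\<close>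

lemma Wpp_triangle:
  assumes p: "1 \<le> p" and a: "0 < a" and b: "0 < b"
    and 1: "Wpp p \<mu> \<nu> < ennreal (a powr p)" and 2: "Wpp p \<nu> \<rho> < ennreal (b powr p)"
  shows "Wpp p \<mu> \<rho> \<le> ennreal ((a + b) powr p)"
proof (rule ennreal_le_powr_limI)
  fix e :: real assume e: "0 < e"
  obtain \<pi> where \<pi>: "\<pi> \<in> couplings \<mu> \<nu>"
    and \<pi>a: "(\<integral>\<^sup>+z. ennreal (\<bar>fst z - snd z\<bar> powr p) \<partial>\<pi>) < ennreal (a powr p)"
    by (rule Wpp_lessE[OF 1])
  obtain \<sigma> where \<sigma>: "\<sigma> \<in> couplings \<nu> \<rho>"
    and \<sigma>b: "(\<integral>\<^sup>+z. ennreal (\<bar>fst z - snd z\<bar> powr p) \<partial>\<sigma>) < ennreal (b powr p)"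
    by (rule Wpp_lessE[OF 2])
  obtain G :: "((real \<times> real) \<times> (real \<times> real)) measure" where
    sG: "sets G = sets ((borel \<Otimes>\<^sub>M borel) \<Otimes>\<^sub>M (borel \<Otimes>\<^sub>M borel))" and "prob_space G"
    and G1: "distr G (borel \<Otimes>\<^sub>M borel) fst = \<pi>" and G2: "distr G (borel \<Otimes>\<^sub>M borel) snd = \<sigma>"
    and close: "AE w in G. \<bar>snd (fst w) - fst (snd w)\<bar> \<le> e"
    by (rule approximate_gluing[OF \<pi> \<sigma> e])
  interpret prob_space G by fact
  note [measurable_cong] = sG
  have "\<mu> = distr G borel (\<lambda>w. fst (fst w))"
    by (simp flip: couplingsD(3)[OF \<pi>] G1 add: distr_distr comp_def)
  moreover have "\<rho> = distr G borel (\<lambda>w. snd (snd w))"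
    by (simp flip: couplingsD(4)[OF \<sigma>] G2 add: distr_distr comp_def)
  ultimately have "Wpp p \<mu> \<rho> \<le> (\<integral>\<^sup>+w. ennreal (\<bar>fst (fst w) - snd (snd w)\<bar> powr p) \<partial>G)"
    by (simp add: Wpp_distr_le \<open>prob_space G\<close>)
  also have "\<dots> \<le> ennreal ((a + (b + e)) powr p)"
  proof (rule Minkowski_nn_integral[OF p a])
    show "(\<integral>\<^sup>+w. ennreal (\<bar>fst (fst w) - snd (fst w)\<bar> powr p) \<partial>G) \<le> ennreal (a powr p)"
      using \<pi>a by (simp flip: G1 add: nn_integral_distr)
    show "(\<integral>\<^sup>+w. ennreal ((\<bar>fst (snd w) - snd (snd w)\<bar> + e) powr p) \<partial>G) \<le> ennreal ((b + e) powr p)"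
    proof (rule Minkowski_nn_integral[OF p b e])
      show "(\<integral>\<^sup>+w. ennreal (\<bar>fst (snd w) - snd (snd w)\<bar> powr p) \<partial>G) \<le> ennreal (b powr p)"
        using \<sigma>b by (simp flip: G2 add: nn_integral_distr)
      show "(\<integral>\<^sup>+w. ennreal (e powr p) \<partial>G) \<le> ennreal (e powr p)"
        by (simp add: emeasure_space_1)
    qed (use e in auto)
    show "AE w in G. 0 \<le> \<bar>fst (fst w) - snd (fst w)\<bar> \<and> 0 \<le> \<bar>fst (snd w) - snd (snd w)\<bar> + e \<and>
        0 \<le> \<bar>fst (fst w) - snd (snd w)\<bar> \<and>
        \<bar>fst (fst w) - snd (snd w)\<bar> \<le> \<bar>fst (fst w) - snd (fst w)\<bar> + (\<bar>fst (snd w) - snd (snd w)\<bar> + e)"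
      using close by eventually_elim (use e in auto)
  qed (use b e in auto)
  finally show "Wpp p \<mu> \<rho> \<le> ennreal ((a + b + e) powr p)" by (simp add: add.assoc)
qed (use a b p in auto)

text \<open>Junk value: \<open>Wp\<close> is 0 where \<open>Wpp\<close> is infinite.\<close>
definition Wp :: "real \<Rightarrow> real measure \<Rightarrow> real measure \<Rightarrow> real" where
  "Wp p \<mu> \<nu> = enn2real (Wpp p \<mu> \<nu>) powr (1 / p)"

lemma Wp_nonneg [simp]: "0 \<le> Wp p \<mu> \<nu>"
  by (simp add: Wp_def)

lemma enn2real_root_powr:
  fixes x :: ennreal
  assumes "1 \<le> p" "x < \<infinity>"
  shows "ennreal ((enn2real x powr (1 / p)) powr p) = x"
  using assms by (simp add: powr_powr)

text \<open>Translates bounds on distances into bounds on their p-th powers, the form in which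
  couplings and Minkowski's inequality are handled.\<close>

lemma enn2real_root_le_iff:
  fixes x :: ennreal
  assumes "1 \<le> p" "x < \<infinity>" "0 \<le> c"
  shows "enn2real x powr (1 / p) \<le> c \<longleftrightarrow> x \<le> ennreal (c powr p)"
proof -
  have "enn2real x powr (1 / p) \<le> c \<longleftrightarrow> (enn2real x powr (1 / p)) powr p \<le> c powr p"
    using assms powr_mono2[of p "enn2real x powr (1 / p)" c] powr_less_mono2[of p c "enn2real x powr (1 / p)"]
    by fastforce
  also have "\<dots> \<longleftrightarrow> x \<le> ennreal (c powr p)"
    using assms enn2real_root_powr[of p x] by (subst ennreal_le_iff[symmetric]) auto
  finally show ?thesis .
qed

text \<open>Finiteness is established as well, since otherwise the real inequality could hold merely
  because of the junk value.\<close>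

lemma Wp_triangle:
  assumes p: "1 \<le> p" and fin: "Wpp p \<mu> \<nu> < \<infinity>" "Wpp p \<nu> \<rho> < \<infinity>"
  shows "Wpp p \<mu> \<rho> < \<infinity>" "Wp p \<mu> \<rho> \<le> Wp p \<mu> \<nu> + Wp p \<nu> \<rho>"
proof -
  have pos: "0 < enn2real x powr (1 / p) + e" if "0 < e" for x e
    using that by (intro add_nonneg_pos) auto
  have lt: "x < ennreal ((enn2real x powr (1 / p) + e) powr p)" if "x < \<infinity>" "0 < e" for x :: ennreal and e
  proof -
    have "ennreal ((enn2real x powr (1 / p)) powr p) < ennreal ((enn2real x powr (1 / p) + e) powr p)"
      using that p pos[of e x] by (intro ennreal_lessI powr_less_mono2) auto
    with enn2real_root_powr[OF p that(1)] show ?thesis by simp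
  qed
  \<comment> \<open>A slack of \<open>e / 2\<close> in each distance makes the bounds positive and
    strict, as \<open>Wpp_triangle\<close> demands.\<close>
  have tri: "Wpp p \<mu> \<rho> \<le> ennreal ((Wp p \<mu> \<nu> + Wp p \<nu> \<rho> + e) powr p)" if "0 < e" for e
    using Wpp_triangle[OF p _ _ lt[OF fin(1), of "e/2"] lt[OF fin(2), of "e/2"]] that pos
    by (simp add: Wp_def algebra_simps)
  show f: "Wpp p \<mu> \<rho> < \<infinity>" using tri[of 1] by (auto intro: le_less_trans)
  show "Wp p \<mu> \<rho> \<le> Wp p \<mu> \<nu> + Wp p \<nu> \<rho>"
    unfolding Wp_def[of p \<mu> \<rho>]
    by (subst enn2real_root_le_iff[OF p f]) (simp, rule ennreal_le_powr_limI[OF _ tri p], simp)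
qed

section \<open>Vanishing Wasserstein distance and cosine integrals\<close>

text \<open>For each \<open>e > 0\<close> some coupling has cost below \<open>e powr p\<close>,
  hence expected distance at most \<open>2 * e\<close>. Since \<open>cos (r * x + s)\<close> is
  Lipschitz with constant \<open>\<bar>r\<bar>\<close>, the two integrals differ by at most
  \<open>\<bar>r\<bar> * (2 * e)\<close>.\<close>

lemma Wpp_eq_0_imp_integral_cos_eq:
  assumes p: "1 \<le> p" and 0: "Wpp p \<mu> \<nu> = 0"
  shows "(\<integral>x. cos (r * x + s) \<partial>\<mu>) = (\<integral>x. cos (r * x + s) \<partial>\<nu>)"
proof -
  let ?c = "\<lambda>x. cos (r * x + s)"
  have bound: "\<bar>(\<integral>x. ?c x \<partial>\<mu>) - (\<integral>x. ?c x \<partial>\<nu>)\<bar> \<le> \<bar>r\<bar> * (2 * e)" if e: "0 < e" for e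
  proof -
    obtain \<pi> where \<pi>: "\<pi> \<in> couplings \<mu> \<nu>"
      and small: "(\<integral>\<^sup>+z. ennreal (\<bar>fst z - snd z\<bar> powr p) \<partial>\<pi>) < ennreal (e powr p)"
      using Wpp_lessE[of p \<mu> \<nu> "ennreal (e powr p)"] 0 e by auto
    note c = couplingsD[OF \<pi>]
    note [measurable_cong] = c(1)
    interpret prob_space \<pi> by (rule c)
    \<comment> \<open>Passes from p-th powers to first powers: beyond \<open>e\<close> one has
      \<open>x / e \<le> (x / e) powr p\<close>. The scaling makes each of the two terms contribute
      at most \<open>e\<close> after integration.\<close>
    have lin: "x \<le> e + e * e powr (- p) * x powr p" if "0 \<le> x" for x
    proof (cases "x \<le> e")
      case False
      then have "1 \<le> x / e" using e by simp
      then have "x / e \<le> (x / e) powr p" using p powr_mono[of 1 p "x / e"] e that by simp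
      then have "x \<le> e * (x / e) powr p" using e by (simp add: field_simps)
      also have "\<dots> = e * e powr (- p) * x powr p"
        using e that by (simp add: powr_divide powr_minus field_simps)
      finally show ?thesis using e by simp
    qed (use e in \<open>auto intro: order_trans\<close>)
    have "(\<integral>\<^sup>+z. ennreal \<bar>fst z - snd z\<bar> \<partial>\<pi>) \<le>
        (\<integral>\<^sup>+z. ennreal e + ennreal (e * e powr (- p)) * ennreal (\<bar>fst z - snd z\<bar> powr p) \<partial>\<pi>)"
      using e lin by (intro nn_integral_mono) (simp flip: ennreal_mult ennreal_plus add: ennreal_leI)
    also have "\<dots> = ennreal e + ennreal (e * e powr (- p)) * (\<integral>\<^sup>+z. ennreal (\<bar>fst z - snd z\<bar> powr p) \<partial>\<pi>)"
      by (subst nn_integral_add) (auto simp: nn_integral_cmult emeasure_space_1)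
    also have "\<dots> \<le> ennreal e + ennreal (e * e powr (- p)) * ennreal (e powr p)"
      using small by (intro add_mono mult_left_mono) auto
    also have "\<dots> = ennreal (2 * e)"
      using e by (simp flip: ennreal_mult ennreal_plus add: powr_minus)
    finally have L1: "(\<integral>\<^sup>+z. ennreal \<bar>fst z - snd z\<bar> \<partial>\<pi>) \<le> ennreal (2 * e)" .
    then have int: "integrable \<pi> (\<lambda>z. \<bar>fst z - snd z\<bar>)"
      by (intro integrableI_bounded) (auto intro: le_less_trans)
    have "(\<integral>z. \<bar>fst z - snd z\<bar> \<partial>\<pi>) \<le> 2 * e"
      using L1 e by (simp add: integral_eq_nn_integral enn2real_leI)
    have cosi: "integrable \<pi> (\<lambda>z. ?c (fst z))" "integrable \<pi> (\<lambda>z. ?c (snd z))"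
      by (auto intro!: integrable_const_bound[where B=1])
    have "(\<integral>x. ?c x \<partial>\<mu>) - (\<integral>x. ?c x \<partial>\<nu>) = (\<integral>z. ?c (fst z) - ?c (snd z) \<partial>\<pi>)"
      using cosi by (simp flip: c(3,4) add: integral_distr)
    also have "\<bar>\<dots>\<bar> \<le> (\<integral>z. \<bar>r\<bar> * \<bar>fst z - snd z\<bar> \<partial>\<pi>)"
    proof (rule integral_abs_bound[THEN order_trans], rule integral_mono)
      fix z :: "real \<times> real"
      have "\<bar>?c x - ?c y\<bar> \<le> \<bar>r\<bar> * \<bar>x - y\<bar>" for x y
      proof -
        have "\<bar>?c x - ?c y\<bar> = 2 * \<bar>sin ((r * x + s + (r * y + s)) / 2)\<bar> * \<bar>sin ((r * y + s - (r * x + s)) / 2)\<bar>"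
          by (simp only: cos_diff_cos abs_mult abs_numeral)
        also have "\<dots> \<le> 2 * 1 * \<bar>(r * y + s - (r * x + s)) / 2\<bar>"
          by (intro mult_mono abs_sin_x_le_abs_x) auto
        also have "\<dots> = \<bar>r * (x - y)\<bar>"
          by (simp add: right_diff_distrib abs_minus_commute)
        finally show ?thesis by (simp add: abs_mult)
      qed
      then show "\<bar>?c (fst z) - ?c (snd z)\<bar> \<le> \<bar>r\<bar> * \<bar>fst z - snd z\<bar>" .
    qed (use int cosi in auto)
    also have "\<dots> = \<bar>r\<bar> * (\<integral>z. \<bar>fst z - snd z\<bar> \<partial>\<pi>)" by simp
    also have "\<dots> \<le> \<bar>r\<bar> * (2 * e)"
      using \<open>_ \<le> 2 * e\<close> by (intro mult_left_mono) auto
    finally show ?thesis .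
  qed
  have "\<bar>(\<integral>x. ?c x \<partial>\<mu>) - (\<integral>x. ?c x \<partial>\<nu>)\<bar> \<le> 0 + d" if "0 < d" for d
  proof -
    \<comment> \<open>The denominator uses \<open>\<bar>r\<bar> + 1\<close> so that
      \<open>r = 0\<close> is included.\<close>
    have "\<bar>r\<bar> * (2 * (d / (2 * (\<bar>r\<bar> + 1)))) = d * (\<bar>r\<bar> / (\<bar>r\<bar> + 1))"
      by (simp add: field_simps)
    also have "\<dots> \<le> d * 1"
      using that by (intro mult_left_mono) (auto simp: field_simps)
    finally show ?thesis
      using bound[of "d / (2 * (\<bar>r\<bar> + 1))"] that by simp
  qed
  then show ?thesis using field_le_epsilon[of "\<bar>(\<integral>x. ?c x \<partial>\<mu>) - (\<integral>x. ?c x \<partial>\<nu>)\<bar>" 0] by auto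
qed

section \<open>Cramer-Wold\<close>

text \<open>Reduces to Levy's uniqueness theorem for characteristic functions by normalising both
  measures with their common mass. The zero measure cannot be normalised and is treated
  apart.\<close>

lemma finite_borel_measure_eqI:
  fixes M N :: "real measure"
  assumes "finite_measure M" "finite_measure N" and sets: "sets M = sets borel" "sets N = sets borel"
    and cos: "\<And>r s. (\<integral>x. cos (r * x + s) \<partial>M) = (\<integral>x. cos (r * x + s) \<partial>N)"
  shows "M = N"
proof -
  interpret M: finite_measure M by fact
  interpret N: finite_measure N by fact
  note [measurable_cong] = sets
  have sp: "space M = UNIV" "space N = UNIV"
    using sets[THEN sets_eq_imp_space_eq] by auto
  \<comment> \<open>With \<open>r = s = 0\<close> the test function is the constant 1.\<close>
  have mass: "measure N UNIV = measure M UNIV"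
    using cos[of 0 0] by (simp add: sp)
  define c where "c = measure M UNIV"
  have em: "emeasure M UNIV = ennreal c" "emeasure N UNIV = ennreal c"
    using M.emeasure_eq_measure[of UNIV] N.emeasure_eq_measure[of UNIV] mass by (auto simp: c_def)
  show ?thesis
  proof (cases "c = 0")
    case True
    then have "emeasure M X = 0" "emeasure N X = 0" if "X \<in> sets borel" for X
      using em emeasure_mono[of X UNIV M] emeasure_mono[of X UNIV N] sets by auto
    with sets show ?thesis by (intro measure_eqI) auto
  next
    case False
    then have c: "0 < c" by (simp add: c_def zero_less_measure_iff)
    let ?n = "\<lambda>K. density K (\<lambda>_. ennreal (1 / c))"
    have rd: "real_distribution (?n K)" if "sets K = sets borel" "emeasure K UNIV = ennreal c" for K
    proof -
      have [simp]: "space K = UNIV" using sets_eq_imp_space_eq[OF that(1)] by simp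
      have "prob_space (?n K)"
        using c that by (intro prob_spaceI) (simp add: emeasure_density flip: ennreal_mult)
      then show ?thesis
        using that by (simp add: real_distribution_def real_distribution_axioms_def)
    qed
    \<comment> \<open>The phase \<open>- (pi / 2)\<close> turns cosine into sine, so cosines with
      phases give both the real and the imaginary part.\<close>
    have char: "char (?n K) t = complex_of_real (1 / c) *
        (complex_of_real (\<integral>x. cos (t * x + 0) \<partial>K) + \<i> * complex_of_real (\<integral>x. cos (t * x + (- (pi / 2))) \<partial>K))"
      if "finite_measure K" "sets K = sets borel" for K t
    proof -
      interpret finite_measure K by fact
      note [measurable_cong] = that(2)
      have int: "integrable K (\<lambda>x. cos (t * x))" "integrable K (\<lambda>x. sin (t * x))"
        by (auto intro!: integrable_const_bound[where B=1])
      have "char (?n K) t = (CLINT x|K. complex_of_real (1 / c) * iexp (t * x))"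
        using c unfolding char_def by (subst integral_density) (auto simp: scaleR_conv_of_real)
      also have "\<dots> = complex_of_real (1 / c) * (CLINT x|K. complex_of_real (cos (t * x)) + \<i> * complex_of_real (sin (t * x)))"
      proof -
        have "iexp y = complex_of_real (cos y) + \<i> * complex_of_real (sin y)" for y
          by (simp add: complex_eq_iff flip: cis_conv_exp)
        then show ?thesis by (simp only: integral_mult_right_zero)
      qed
      also have "\<dots> = complex_of_real (1 / c) * (complex_of_real (\<integral>x. cos (t * x) \<partial>K) + \<i> * complex_of_real (\<integral>x. sin (t * x) \<partial>K))"
        using int by (subst Bochner_Integration.integral_add) auto
      finally show ?thesis by (simp add: cos_diff)
    qed
    have "?n M = ?n N"
    proof (rule Levy_uniqueness)
      show "char (?n M) = char (?n N)"
        by (rule ext) (simp only: char assms)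
    qed (use rd sets em in auto)
    have "emeasure M X = emeasure N X" if [measurable]: "X \<in> sets borel" for X
    proof -
      have "ennreal c * emeasure (?n M) X = ennreal c * emeasure (?n N) X"
        by (simp only: \<open>?n M = ?n N\<close>)
      then show ?thesis
        using c by (simp add: emeasure_density nn_integral_cmult sets mult.assoc[symmetric] flip: ennreal_mult)
    qed
    with sets show ?thesis by (intro measure_eqI) auto
  qed
qed

text \<open>Testing against \<open>indicator C\<close> times the characters \<open>cos (\<langle>t, \<cdot>\<rangle> + s)\<close> is stable under
  cutting \<open>C\<close> by one cylinder: apply one-dimensional uniqueness to the push-forward along \<open>b\<close>
  of the measure with nonnegative density \<open>indicator C * (1 + cos (\<langle>t, \<cdot>\<rangle> + s))\<close>. Iterating this
  gives the Cramer-Wold theorem without finite-dimensional Fourier inversion.\<close>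

definition cos_equal_on :: "'a::real_inner measure \<Rightarrow> 'a measure \<Rightarrow> 'a set \<Rightarrow> bool" where
  "cos_equal_on \<mu> \<nu> C \<longleftrightarrow> C \<in> sets borel \<and>
    (\<forall>t s. (\<integral>x. indicator C x * cos (inner t x + s) \<partial>\<mu>) = (\<integral>x. indicator C x * cos (inner t x + s) \<partial>\<nu>))"

lemma cos_equal_on_Int_cylinder:
  fixes \<mu> \<nu> :: "'a::{real_inner, second_countable_topology} measure"
  assumes "prob_space \<mu>" "prob_space \<nu>" and sets: "sets \<mu> = sets borel" "sets \<nu> = sets borel"
    and C: "cos_equal_on \<mu> \<nu> C" and A: "A \<in> sets borel"
  shows "cos_equal_on \<mu> \<nu> (C \<inter> {x. inner b x \<in> A})"
proof -
  have C_s[measurable]: "C \<in> sets borel"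
    and eq: "\<And>t s. (\<integral>x. indicator C x * cos (inner t x + s) \<partial>\<mu>) = (\<integral>x. indicator C x * cos (inner t x + s) \<partial>\<nu>)"
    using C by (auto simp: cos_equal_on_def)
  note [measurable] = A
  let ?D = "C \<inter> {x. inner b x \<in> A}"
  \<comment> \<open>For \<open>\<bar>k\<bar> \<le> 1\<close> this is nonnegative and thus a density.
    Only \<open>k = 1\<close> and \<open>k = 0\<close> are used in the end: their difference
    isolates the cosine.\<close>
  define u :: "real \<Rightarrow> 'a \<Rightarrow> real \<Rightarrow> 'a \<Rightarrow> real"
    where "u k t s x = indicator C x * (1 + k * cos (inner t x + s))" for k t s x
  have u0: "0 \<le> u k t s x" and u2: "\<bar>u k t s x\<bar> \<le> 2" if "\<bar>k\<bar> \<le> 1" for k t s x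
  proof -
    have "\<bar>k * cos (inner t x + s)\<bar> \<le> 1 * 1"
      unfolding abs_mult using that by (intro mult_mono) auto
    then show "0 \<le> u k t s x" "\<bar>u k t s x\<bar> \<le> 2" by (auto simp: u_def split: split_indicator)
  qed
  have [measurable]: "u k t s \<in> borel_measurable borel" for k t s
    unfolding u_def by measurable
  let ?P = "\<lambda>K k t s. distr (density K (\<lambda>x. ennreal (u k t s x))) borel (inner b)"
  have P_eq: "?P \<mu> k t s = ?P \<nu> k t s" if k: "\<bar>k\<bar> \<le> 1" for k t s
  proof -
    have fin: "finite_measure (?P K k t s)" if "prob_space K" "sets K = sets borel" for K
    proof -
      interpret prob_space K by fact
      note [measurable_cong] = that(2)
      have "(\<integral>\<^sup>+x. ennreal (u k t s x) \<partial>K) \<le> (\<integral>\<^sup>+x. ennreal 2 \<partial>K)"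
        using u2[OF k] by (intro nn_integral_mono ennreal_leI) (auto intro: abs_le_D1)
      also have "\<dots> < \<infinity>" by (simp add: emeasure_space_1 del: ennreal_numeral)
      also have "(\<integral>\<^sup>+x. ennreal (u k t s x) \<partial>K) =
          emeasure (density K (\<lambda>x. ennreal (u k t s x))) (space K)"
        by (subst emeasure_density) (auto intro!: nn_integral_cong)
      finally have "finite_measure (density K (\<lambda>x. ennreal (u k t s x)))"
        by (intro finite_measureI) simp
      then show ?thesis by (rule finite_measure.finite_measure_distr) simp
    qed
    \<comment> \<open>The product-to-sum formula writes a cosine test of the push-forward as a
      combination of tests of \<open>C\<close> at the frequencies \<open>r *\<^sub>R b\<close> and
      \<open>r *\<^sub>R b \<mp> t\<close>, all of which agree by hypothesis.\<close>
    have expand: "(\<integral>y. cos (r * y + q) \<partial>(?P K k t s)) =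
        (\<integral>x. indicator C x * cos (inner (r *\<^sub>R b) x + q) \<partial>K) +
        k / 2 * ((\<integral>x. indicator C x * cos (inner (r *\<^sub>R b - t) x + (q - s)) \<partial>K) +
                 (\<integral>x. indicator C x * cos (inner (r *\<^sub>R b + t) x + (q + s)) \<partial>K))"
      if "prob_space K" "sets K = sets borel" for K r q
    proof -
      interpret prob_space K by fact
      note [measurable_cong] = that(2)
      have int: "integrable K (\<lambda>x. indicator C x * cos (inner w x + v))" for w v
        by (intro integrable_const_bound[where B=1]) (auto split: split_indicator)
      have "(\<integral>y. cos (r * y + q) \<partial>(?P K k t s)) = (\<integral>x. u k t s x * cos (r * inner b x + q) \<partial>K)"
        using u0[OF k] by (subst integral_distr, simp, simp, subst integral_density) auto
      also have "\<dots> = (\<integral>x. indicator C x * cos (inner (r *\<^sub>R b) x + q) +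
          (k / 2 * (indicator C x * cos (inner (r *\<^sub>R b - t) x + (q - s))) +
           k / 2 * (indicator C x * cos (inner (r *\<^sub>R b + t) x + (q + s)))) \<partial>K)"
      proof (rule Bochner_Integration.integral_cong[OF refl])
        fix x
        have "cos (inner t x + s) * cos (r * inner b x + q) =
            (cos (inner (r *\<^sub>R b - t) x + (q - s)) + cos (inner (r *\<^sub>R b + t) x + (q + s))) / 2"
          by (subst mult.commute, subst cos_times_cos) (simp add: algebra_simps inner_diff_left inner_add_left)
        then have "(1 + k * cos (inner t x + s)) * cos (r * inner b x + q) = cos (r * inner b x + q) +
            k * ((cos (inner (r *\<^sub>R b - t) x + (q - s)) + cos (inner (r *\<^sub>R b + t) x + (q + s))) / 2)"
          by (simp only: distrib_right mult.assoc mult_1_left)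
        then show "u k t s x * cos (r * inner b x + q) = indicator C x * cos (inner (r *\<^sub>R b) x + q) +
          (k / 2 * (indicator C x * cos (inner (r *\<^sub>R b - t) x + (q - s))) +
           k / 2 * (indicator C x * cos (inner (r *\<^sub>R b + t) x + (q + s))))"
          by (simp add: u_def distrib_left add_divide_distrib split: split_indicator)
      qed
      also have "\<dots> = (\<integral>x. indicator C x * cos (inner (r *\<^sub>R b) x + q) \<partial>K) +
        k / 2 * ((\<integral>x. indicator C x * cos (inner (r *\<^sub>R b - t) x + (q - s)) \<partial>K) +
                 (\<integral>x. indicator C x * cos (inner (r *\<^sub>R b + t) x + (q + s)) \<partial>K))"
        unfolding distrib_left[of "k / 2"]
        by (subst Bochner_Integration.integral_add Bochner_Integration.integral_mult_right_zero,
            (intro Bochner_Integration.integrable_add integrable_mult_right int)+)+ (simp only: Bochner_Integration.integral_mult_right_zero)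
      finally show ?thesis .
    qed
    show ?thesis
      by (rule finite_borel_measure_eqI) (auto simp only: fin assms sets_distr expand eq)
  qed
  \<comment> \<open>Evaluate the equal push-forwards at \<open>A\<close>; its preimage along
    \<open>b\<close> is the new cylinder.\<close>
  have u_eq: "(\<integral>x. indicator ?D x * (1 + k * cos (inner t x + s)) \<partial>\<mu>) =
      (\<integral>x. indicator ?D x * (1 + k * cos (inner t x + s)) \<partial>\<nu>)" if k: "\<bar>k\<bar> \<le> 1" for k t s
  proof -
    have "(\<integral>y. indicator A y \<partial>(?P K k t s)) = (\<integral>x. indicator ?D x * (1 + k * cos (inner t x + s)) \<partial>K)"
      if "sets K = sets borel" for K
    proof -
      note [measurable_cong] = that
      have "(\<integral>y. indicator A y \<partial>(?P K k t s)) = (\<integral>x. u k t s x * indicator A (inner b x) \<partial>K)"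
        using u0[OF k] by (subst integral_distr, simp, simp, subst integral_density) auto
      also have "\<dots> = (\<integral>x. indicator ?D x * (1 + k * cos (inner t x + s)) \<partial>K)"
        by (intro Bochner_Integration.integral_cong) (auto simp: u_def split: split_indicator)
      finally show ?thesis .
    qed
    from this[OF sets(1)] this[OF sets(2)] P_eq[OF k] show ?thesis by simp
  qed
  have split: "(\<integral>x. indicator ?D x * (1 + 1 * cos (inner t x + s)) \<partial>K) =
      (\<integral>x. indicator ?D x * (1 + 0 * cos (inner t x + s)) \<partial>K) + (\<integral>x. indicator ?D x * cos (inner t x + s) \<partial>K)"
    if "prob_space K" "sets K = sets borel" for K t s
  proof -
    interpret prob_space K by fact
    note [measurable_cong] = that(2)
    have int: "integrable K (\<lambda>x. indicator ?D x * cos (inner t x + s))"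
      by (intro integrable_const_bound[where B=1]) (auto split: split_indicator)
    have int1: "integrable K (\<lambda>x. indicator ?D x * (1 + 0 * cos (inner t x + s)))"
      by (intro integrable_const_bound[where B=1]) (auto split: split_indicator)
    show ?thesis
      by (subst Bochner_Integration.integral_add[OF int1 int, symmetric]) (simp add: distrib_left)
  qed
  have "(\<integral>x. indicator ?D x * cos (inner t x + s) \<partial>\<mu>) = (\<integral>x. indicator ?D x * cos (inner t x + s) \<partial>\<nu>)" for t s
    using split[OF assms(1) sets(1), of t s] split[OF assms(2) sets(2), of t s]
      u_eq[of 1 t s] u_eq[of 0 t s] by simp
  then show ?thesis by (simp add: cos_equal_on_def)
qed

text \<open>Finite intersections of one-dimensional cylinders, built one factor at a time so that
  induction matches \<open>cos_equal_on_Int_cylinder\<close>.\<close>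

inductive_set cylinders :: "'a::real_inner set set" where
  UNIV: "UNIV \<in> cylinders"
| Int: "C \<in> cylinders \<Longrightarrow> A \<in> sets borel \<Longrightarrow> C \<inter> {x. inner b x \<in> A} \<in> cylinders"

lemma Int_stable_cylinders: "Int_stable cylinders"
proof (rule Int_stableI)
  fix C D :: "'a set" assume C: "C \<in> cylinders" and "D \<in> cylinders"
  from this(2) show "C \<inter> D \<in> cylinders"
    by induction (use C in \<open>auto simp flip: Int_assoc intro: cylinders.Int\<close>)
qed

lemma cylinders_borel: "C \<in> cylinders \<Longrightarrow> C \<in> sets (borel :: 'a::{real_inner, second_countable_topology} measure)"
proof (induction rule: cylinders.induct)
  case (Int C A b)
  note [measurable] = Int
  show ?case by measurable
qed simp

text \<open>Closed balls are countable intersections of half-spaces, since the norm is the supremum of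
  \<open>\<lambda>x. \<langle>d, x\<rangle>\<close> over a countable dense set of \<open>d\<close> in the unit ball.\<close>

lemma borel_eq_sigma_cylinders:
  "sets (borel :: 'a::{real_inner, second_countable_topology} measure) = sigma_sets UNIV cylinders"
proof
  let ?S = "sigma UNIV (cylinders :: 'a set set)"
  have sS: "sets ?S = sigma_sets UNIV cylinders" by (simp add: sets_measure_of)
  have spS: "space ?S = UNIV" by (simp add: space_measure_of_conv)
  obtain D :: "'a set" where "countable D" and D: "\<And>X. open X \<Longrightarrow> X \<noteq> {} \<Longrightarrow> \<exists>d\<in>D. d \<in> X"
    by (rule countable_dense_setE) blast
  have half: "{x. inner d x \<le> c} \<in> sets ?S" for d :: 'a and c
    using cylinders.Int[OF cylinders.UNIV, of "{..c}" d] unfolding sS by (auto simp: sigma_sets.Basic)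
  \<comment> \<open>The factor \<open>norm d\<close> lets \<open>d\<close> range over a dense subset
    of the whole space. For the converse, if \<open>norm y > r\<close>, the strict inequality holds
    at \<open>d = y\<close> and hence on an open set, which meets \<open>D\<close>.\<close>
  have norm_le: "norm y \<le> r \<longleftrightarrow> (\<forall>d\<in>D. inner d y \<le> r * norm d)" if r: "0 \<le> r" for y :: 'a and r
  proof (intro iffI ballI)
    fix d :: 'a assume "norm y \<le> r"
    then have "norm d * norm y \<le> norm d * r" by (intro mult_left_mono) auto
    then show "inner d y \<le> r * norm d"
      using norm_cauchy_schwarz[of d y] by (simp add: mult.commute)
  next
    assume le: "\<forall>d\<in>D. inner d y \<le> r * norm d"
    show "norm y \<le> r"
    proof (rule ccontr)
      assume "\<not> norm y \<le> r"
      then have "r * norm y < norm y * norm y"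
        using r by (intro mult_strict_right_mono) auto
      then have "y \<in> {d. r * norm d < inner d y}"
        by (simp add: power2_eq_square flip: power2_norm_eq_inner)
      moreover have "open {d. r * norm d < inner d y}"
        by (intro open_Collect_less continuous_intros)
      ultimately show False using D le by force
    qed
  qed
  have cball_eq: "cball c r = (\<Inter>d\<in>D. {x. inner d x \<le> r * norm d + inner d c})" if "0 \<le> r" for c :: 'a and r
  proof -
    have "x \<in> cball c r \<longleftrightarrow> norm (x - c) \<le> r" for x
      by (simp add: dist_norm norm_minus_commute)
    then show ?thesis
      by (auto simp: norm_le[OF that] inner_diff_right algebra_simps)
  qed
  have "D \<noteq> {}" using D[of UNIV] by auto
  then have cball: "cball c r \<in> sets ?S" if "0 \<le> r" for c :: 'a and r
    unfolding cball_eq[OF that] using \<open>countable D\<close> half by (intro sets.countable_INT') auto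
  have "U \<in> sets ?S" if "open U" for U :: "'a set"
  proof -
    let ?I = "{(d, r). d \<in> D \<and> r \<in> \<rat> \<and> 0 \<le> r \<and> cball d r \<subseteq> U}"
    have "?I \<subseteq> D \<times> \<rat>" by auto
    then have "countable ?I"
      by (rule countable_subset) (intro countable_SIGMA \<open>countable D\<close> countable_rat)
    have "U = (\<Union>(d, r)\<in>?I. cball d r)"
    proof (intro equalityI subsetI)
      fix x assume "x \<in> U"
      with \<open>open U\<close> obtain e where e: "0 < e" "ball x e \<subseteq> U" by (auto simp: open_contains_ball)
      obtain d where d: "d \<in> D" "d \<in> ball x (e / 3)" using D[of "ball x (e / 3)"] e by auto
      \<comment> \<open>With \<open>d\<close> within \<open>e / 3\<close> of \<open>x\<close>, a
        radius above \<open>e / 3\<close> captures \<open>x\<close>, and one below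
        \<open>e / 2\<close> keeps the ball inside \<open>ball x e\<close>.\<close>
      obtain r where r: "r \<in> \<rat>" "e / 3 < r" "r < e / 2" using Rats_dense_in_real[of "e / 3" "e / 2"] e by auto
      have "cball d r \<subseteq> ball x e"
      proof
        fix z assume "z \<in> cball d r"
        then show "z \<in> ball x e" using d r e dist_triangle[of x z d] by auto
      qed
      with d r e have "(d, r) \<in> ?I" "x \<in> cball d r" by (auto simp: dist_commute)
      then show "x \<in> (\<Union>(d, r)\<in>?I. cball d r)" by blast
    qed auto
    also have "\<dots> \<in> sets ?S"
      using \<open>countable ?I\<close> cball by (intro sets.countable_UN') auto
    finally show ?thesis .
  qed
  then have "sigma_sets (space ?S) {U. open U} \<subseteq> sets ?S"
    by (intro sets.sigma_sets_subset) auto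
  then show "sets (borel :: 'a measure) \<subseteq> sigma_sets UNIV cylinders"
    by (simp add: sS spS borel_def sets_measure_of)
  show "sigma_sets UNIV cylinders \<subseteq> sets (borel :: 'a measure)"
    using cylinders_borel by (intro sets.sigma_sets_subset') auto
qed

text \<open>The hypothesis is \<open>cos_equal_on\<close> for \<open>UNIV\<close>; induction carries
  it to all cylinders. Taking \<open>t = s = 0\<close> there yields equal measures on an
  intersection-stable generator of the Borel sets.\<close>

theorem Cramer_Wold_cos:
  fixes \<mu> \<nu> :: "'a::{real_inner, second_countable_topology} measure"
  assumes "prob_space \<mu>" "prob_space \<nu>" and sets: "sets \<mu> = sets borel" "sets \<nu> = sets borel"
    and cos: "\<And>t s. (\<integral>x. cos (inner t x + s) \<partial>\<mu>) = (\<integral>x. cos (inner t x + s) \<partial>\<nu>)"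
  shows "\<mu> = \<nu>"
proof -
  interpret \<mu>: prob_space \<mu> by fact
  interpret \<nu>: prob_space \<nu> by fact
  have sp: "space \<mu> = UNIV" "space \<nu> = UNIV"
    using sets[THEN sets_eq_imp_space_eq] by auto
  have cyl: "cos_equal_on \<mu> \<nu> C" if "C \<in> cylinders" for C
    using that
  proof induction
    case UNIV
    then show ?case using cos by (simp add: cos_equal_on_def)
  next
    case (Int C A b)
    then show ?case using cos_equal_on_Int_cylinder[OF assms(1-4)] by blast
  qed
  show ?thesis
  proof (rule measure_eqI_generator_eq[OF Int_stable_cylinders, where A="\<lambda>_. UNIV"])
    fix C :: "'a set" assume "C \<in> cylinders"
    from cyl[OF this] have "C \<in> sets borel" and "(\<integral>x. indicator C x * cos (inner 0 x + 0) \<partial>\<mu>) = (\<integral>x. indicator C x * cos (inner 0 x + 0) \<partial>\<nu>)"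
      unfolding cos_equal_on_def by blast+
    then have "measure \<mu> C = measure \<nu> C" using sp by simp
    then show "emeasure \<mu> C = emeasure \<nu> C"
      by (simp add: \<mu>.emeasure_eq_measure \<nu>.emeasure_eq_measure)
  qed (auto simp: sets borel_eq_sigma_cylinders cylinders.UNIV)
qed

section \<open>The sliced distance\<close>

text \<open>The L^p norm of the identity under \<open>\<mu>\<close>. It is the Lipschitz constant of
  the projections as functions of the direction.\<close>

definition moment_norm :: "real \<Rightarrow> 'a::real_normed_vector measure \<Rightarrow> real" where
  "moment_norm p \<mu> = enn2real (\<integral>\<^sup>+ x. ennreal (norm x powr p) \<partial>\<mu>) powr (1 / p)"

lemma PpD:
  assumes "\<mu> \<in> Pp p"
  shows "sets \<mu> = sets borel" "prob_space \<mu>" "(\<integral>\<^sup>+ x. ennreal (norm x powr p) \<partial>\<mu>) < \<infinity>"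
  using assms unfolding Pp_def by blast+

lemma moment_norm_nonneg [simp]: "0 \<le> moment_norm p \<mu>"
  by (simp add: moment_norm_def)

lemma Wpp_proj_measure_le:
  fixes \<mu> :: "'a::{real_inner, second_countable_topology} measure"
  assumes p: "1 \<le> p" and \<mu>: "\<mu> \<in> Pp p"
  shows "Wpp p (proj_measure \<mu> \<theta>) (proj_measure \<mu> \<theta>') \<le> ennreal ((norm (\<theta> - \<theta>') * moment_norm p \<mu>) powr p)"
proof -
  note [measurable_cong] = PpD(1)[OF \<mu>]
  have "Wpp p (proj_measure \<mu> \<theta>) (proj_measure \<mu> \<theta>') \<le> (\<integral>\<^sup>+x. ennreal (\<bar>inner \<theta> x - inner \<theta>' x\<bar> powr p) \<partial>\<mu>)"
    unfolding proj_measure_def by (rule Wpp_distr_le) (auto intro: PpD[OF \<mu>])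
  also have "\<dots> \<le> (\<integral>\<^sup>+x. ennreal (norm (\<theta> - \<theta>') powr p) * ennreal (norm x powr p) \<partial>\<mu>)"
  proof (rule nn_integral_mono)
    fix x
    have "\<bar>inner \<theta> x - inner \<theta>' x\<bar> powr p \<le> (norm (\<theta> - \<theta>') * norm x) powr p"
      using p by (intro powr_mono2) (auto simp: Cauchy_Schwarz_ineq2 simp flip: inner_diff_left)
    then show "ennreal (\<bar>inner \<theta> x - inner \<theta>' x\<bar> powr p) \<le> ennreal (norm (\<theta> - \<theta>') powr p) * ennreal (norm x powr p)"
      by (simp add: powr_mult ennreal_leI flip: ennreal_mult)
  qed
  also have "\<dots> = ennreal (norm (\<theta> - \<theta>') powr p) * (\<integral>\<^sup>+x. ennreal (norm x powr p) \<partial>\<mu>)"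
    by (rule nn_integral_cmult) simp
  also have "(\<integral>\<^sup>+x. ennreal (norm x powr p) \<partial>\<mu>) = ennreal (moment_norm p \<mu> powr p)"
    unfolding moment_norm_def by (rule enn2real_root_powr[OF p PpD(3)[OF \<mu>], symmetric])
  also have "ennreal (norm (\<theta> - \<theta>') powr p) * \<dots> = ennreal ((norm (\<theta> - \<theta>') * moment_norm p \<mu>) powr p)"
    by (simp add: powr_mult flip: ennreal_mult)
  finally show ?thesis .
qed

lemma Wp_proj_measure_le:
  fixes \<mu> :: "'a::{real_inner, second_countable_topology} measure"
  assumes p: "1 \<le> p" and \<mu>: "\<mu> \<in> Pp p"
  shows "Wpp p (proj_measure \<mu> \<theta>) (proj_measure \<mu> \<theta>') < \<infinity>"
    "Wp p (proj_measure \<mu> \<theta>) (proj_measure \<mu> \<theta>') \<le> norm (\<theta> - \<theta>') * moment_norm p \<mu>"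
proof -
  note le = Wpp_proj_measure_le[OF assms, of \<theta> \<theta>']
  show fin: "Wpp p (proj_measure \<mu> \<theta>) (proj_measure \<mu> \<theta>') < \<infinity>"
    using le by (rule le_less_trans) simp
  show "Wp p (proj_measure \<mu> \<theta>) (proj_measure \<mu> \<theta>') \<le> norm (\<theta> - \<theta>') * moment_norm p \<mu>"
    unfolding Wp_def by (subst enn2real_root_le_iff[OF p fin]) (simp_all add: le)
qed

lemma proj_measure_0:
  fixes \<mu> :: "'a::{real_inner, second_countable_topology} measure"
  assumes "\<mu> \<in> Pp p"
  shows "proj_measure \<mu> 0 = return borel 0"
proof -
  interpret prob_space \<mu> using PpD[OF assms] by blast
  show ?thesis
    by (rule measure_eqI) (auto simp: proj_measure_def emeasure_distr emeasure_space_1 vimage_def split: split_indicator)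
qed

text \<open>Triangle inequality through the direction 0, where both projections coincide. On the
  sphere the bound is uniform, which later gives integrability.\<close>

lemma Wp_proj_measure_finite:
  fixes \<mu> \<nu> :: "'a::{real_inner, second_countable_topology} measure"
  assumes p: "1 \<le> p" and \<mu>: "\<mu> \<in> Pp p" and \<nu>: "\<nu> \<in> Pp p"
  shows "Wpp p (proj_measure \<mu> \<theta>) (proj_measure \<nu> \<theta>) < \<infinity>"
    "Wp p (proj_measure \<mu> \<theta>) (proj_measure \<nu> \<theta>) \<le> norm \<theta> * (moment_norm p \<mu> + moment_norm p \<nu>)"
proof -
  have \<nu>0: "proj_measure \<nu> 0 = proj_measure \<mu> 0"
    by (simp add: proj_measure_0[OF \<mu>] proj_measure_0[OF \<nu>])
  note 1 = Wp_proj_measure_le[OF p \<mu>, of \<theta> 0]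
  note 2 = Wp_proj_measure_le[OF p \<nu>, of 0 \<theta>, unfolded \<nu>0]
  show "Wpp p (proj_measure \<mu> \<theta>) (proj_measure \<nu> \<theta>) < \<infinity>"
    by (rule Wp_triangle(1)[OF p 1(1) 2(1)])
  show "Wp p (proj_measure \<mu> \<theta>) (proj_measure \<nu> \<theta>) \<le> norm \<theta> * (moment_norm p \<mu> + moment_norm p \<nu>)"
    using Wp_triangle(2)[OF p 1(1) 2(1)] 1(2) 2(2) by (simp add: distrib_left)
qed

text \<open>Insert both projections along \<open>\<theta>'\<close> between those along
  \<open>\<theta>\<close>: the two triangle inequalities cost at most the sum of the moment norms
  times \<open>norm (\<theta> - \<theta>')\<close>.\<close>

lemma continuous_on_Wp_proj_measure:
  fixes \<mu> \<nu> :: "'a::{real_inner, second_countable_topology} measure"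
  assumes p: "1 \<le> p" and \<mu>: "\<mu> \<in> Pp p" and \<nu>: "\<nu> \<in> Pp p"
  shows "continuous_on A (\<lambda>\<theta>. Wp p (proj_measure \<mu> \<theta>) (proj_measure \<nu> \<theta>))"
proof -
  let ?D = "\<lambda>\<theta>. Wp p (proj_measure \<mu> \<theta>) (proj_measure \<nu> \<theta>)"
  define L where "L = moment_norm p \<mu> + moment_norm p \<nu>"
  have le: "?D \<theta> \<le> ?D \<theta>' + norm (\<theta> - \<theta>') * L" for \<theta> \<theta>'
  proof -
    note 1 = Wp_proj_measure_le[OF p \<mu>, of \<theta> \<theta>']
    note 2 = Wp_proj_measure_finite(1)[OF p \<mu> \<nu>, of \<theta>']
    note 3 = Wp_proj_measure_le[OF p \<nu>, of \<theta>' \<theta>]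
    note 4 = Wp_triangle[OF p 2 3(1)]
    show ?thesis
      using Wp_triangle(2)[OF p 1(1) 4(1)] 1(2) 3(2) 4(2)
      by (simp add: L_def distrib_left norm_minus_commute)
  qed
  have "L-lipschitz_on A ?D"
  proof (rule lipschitz_onI)
    show "dist (?D \<theta>) (?D \<theta>') \<le> L * dist \<theta> \<theta>'" for \<theta> \<theta>'
      using le[of \<theta> \<theta>'] le[of \<theta>' \<theta>]
      by (simp add: dist_real_def abs_le_iff dist_norm norm_minus_commute mult.commute)
  qed (simp add: L_def)
  then show ?thesis by (rule lipschitz_on_continuous_on)
qed

theorem mainTheorem3:
  fixes p :: real
    and \<gamma> :: "'a::{real_inner, complete_space, second_countable_topology} measure"
  assumes infdim: "\<not> (\<exists>B :: 'a set. finite B \<and> span B = UNIV)"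
    and p: "1 \<le> p"
    and \<gamma>_space: "space \<gamma> = unit_sphere"
    and \<gamma>_sets: "sets \<gamma> = sets (restrict_space borel unit_sphere)"
    and \<gamma>_fin: "finite_measure \<gamma>"
    and \<gamma>_pos: "emeasure \<gamma> unit_sphere > 0"
    and \<gamma>_strict: "\<And>U. openin (top_of_set unit_sphere) U \<Longrightarrow> U \<noteq> {} \<Longrightarrow> emeasure \<gamma> U > 0"
  shows "(\<forall>\<mu>\<in>Pp p. \<forall>\<nu>\<in>Pp p. SWpp p \<gamma> \<mu> \<nu> < \<infinity>)
       \<and> (\<forall>\<mu>\<in>Pp p. \<forall>\<nu>\<in>Pp p. SW p \<gamma> \<mu> \<nu> = SW p \<gamma> \<nu> \<mu>)
       \<and> (\<forall>\<mu>\<in>Pp p. \<forall>\<nu>\<in>Pp p. \<forall>\<rho>\<in>Pp p. SW p \<gamma> \<mu> \<rho> \<le> SW p \<gamma> \<mu> \<nu> + SW p \<gamma> \<nu> \<rho>)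
       \<and> (\<forall>\<mu>\<in>Pp p. \<forall>\<nu>\<in>Pp p. SW p \<gamma> \<mu> \<nu> = 0 \<longleftrightarrow> \<mu> = \<nu>)"
proof -
  interpret finite_measure \<gamma> by fact
  let ?S = "unit_sphere :: 'a set"
  define D where "D \<mu> \<nu> \<theta> = Wp p (proj_measure \<mu> \<theta>) (proj_measure \<nu> \<theta>)" for \<mu> \<nu> :: "'a measure" and \<theta>
  define I where "I \<mu> \<nu> = (\<integral>\<^sup>+\<theta>. ennreal (D \<mu> \<nu> \<theta> powr p) \<partial>\<gamma>)" for \<mu> \<nu>
  define c where "c = measure \<gamma> ?S"
  have c: "emeasure \<gamma> ?S = ennreal c" "0 < c"
    using emeasure_eq_measure[of ?S] \<gamma>_pos by (auto simp: c_def)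
  have D_nonneg: "0 \<le> D \<mu> \<nu> \<theta>" for \<mu> \<nu> \<theta> by (simp add: D_def)
  have D_cont: "continuous_on A (D \<mu> \<nu>)" if "\<mu> \<in> Pp p" "\<nu> \<in> Pp p" for A \<mu> \<nu>
    unfolding D_def using that by (rule continuous_on_Wp_proj_measure[OF p])
  \<comment> \<open>The sigma-algebra of \<open>\<gamma>\<close> is the Borel trace on the sphere,
    so continuity there suffices.\<close>
  have D_meas: "D \<mu> \<nu> \<in> borel_measurable \<gamma>" if "\<mu> \<in> Pp p" "\<nu> \<in> Pp p" for \<mu> \<nu>
    unfolding measurable_cong_sets[OF \<gamma>_sets refl]
    by (rule borel_measurable_continuous_on_restrict[OF D_cont[OF that]])
  have Wpp_eq: "Wpp p (proj_measure \<mu> \<theta>) (proj_measure \<nu> \<theta>) = ennreal (D \<mu> \<nu> \<theta> powr p)"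
    if "\<mu> \<in> Pp p" "\<nu> \<in> Pp p" for \<mu> \<nu> \<theta>
    unfolding D_def Wp_def
    by (rule enn2real_root_powr[OF p Wp_proj_measure_finite(1)[OF p that], symmetric])
  have I_fin: "I \<mu> \<nu> < \<infinity>" if "\<mu> \<in> Pp p" "\<nu> \<in> Pp p" for \<mu> \<nu>
  proof -
    let ?B = "(moment_norm p \<mu> + moment_norm p \<nu>) powr p"
    have "I \<mu> \<nu> \<le> (\<integral>\<^sup>+\<theta>. ennreal ?B \<partial>\<gamma>)"
      unfolding I_def
    proof (rule nn_integral_mono)
      fix \<theta> assume "\<theta> \<in> space \<gamma>"
      then have "norm \<theta> = 1" by (simp add: \<gamma>_space unit_sphere_def)
      then have "D \<mu> \<nu> \<theta> \<le> moment_norm p \<mu> + moment_norm p \<nu>"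
        using Wp_proj_measure_finite(2)[OF p that, of \<theta>] by (simp add: D_def)
      then show "ennreal (D \<mu> \<nu> \<theta> powr p) \<le> ennreal ?B"
        using p D_nonneg by (intro ennreal_leI powr_mono2) auto
    qed
    also have "\<dots> = ennreal ?B * ennreal c" by (simp add: c \<gamma>_space)
    also have "\<dots> < \<infinity>" by (simp add: ennreal_mult_less_top)
    finally show ?thesis .
  qed
  have SWpp_eq: "SWpp p \<gamma> \<mu> \<nu> = ennreal (enn2real (I \<mu> \<nu>) / c)" if "\<mu> \<in> Pp p" "\<nu> \<in> Pp p" for \<mu> \<nu>
  proof -
    have "SWpp p \<gamma> \<mu> \<nu> = ennreal (enn2real (I \<mu> \<nu>)) / ennreal c"
      using I_fin[OF that] by (simp add: SWpp_def c I_def Wpp_eq[OF that])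
    then show ?thesis using c by (simp add: divide_ennreal)
  qed
  have fin: "SWpp p \<gamma> \<mu> \<nu> < \<infinity>" if "\<mu> \<in> Pp p" "\<nu> \<in> Pp p" for \<mu> \<nu>
    by (simp add: SWpp_eq[OF that])
  \<comment> \<open>The p-th root of the total mass: \<open>SW\<close> is the L^p norm of
    \<open>D\<close> divided by \<open>k\<close>, so a bound \<open>a\<close> for \<open>SW\<close>
    means a bound \<open>k * a\<close> for that norm.\<close>
  define k where "k = c powr (1 / p)"
  have k: "0 < k" "k powr p = c" using c p by (auto simp: k_def powr_powr)
  have SW_le_iff: "SW p \<gamma> \<mu> \<nu> \<le> a \<longleftrightarrow> I \<mu> \<nu> \<le> ennreal ((k * a) powr p)"
    if "\<mu> \<in> Pp p" "\<nu> \<in> Pp p" "0 \<le> a" for \<mu> \<nu> a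
  proof -
    have I_real: "ennreal (enn2real (I \<mu> \<nu>)) = I \<mu> \<nu>"
      using I_fin[OF that(1,2)] by simp
    have "SW p \<gamma> \<mu> \<nu> \<le> a \<longleftrightarrow> enn2real (I \<mu> \<nu>) / c \<le> a powr p"
      unfolding SW_def using that c
      by (subst enn2real_root_le_iff[OF p fin]) (auto simp: SWpp_eq)
    also have "\<dots> \<longleftrightarrow> enn2real (I \<mu> \<nu>) \<le> (k * a) powr p"
      using c k that by (simp add: powr_mult field_simps)
    also have "\<dots> \<longleftrightarrow> ennreal (enn2real (I \<mu> \<nu>)) \<le> ennreal ((k * a) powr p)"
      by (subst ennreal_le_iff) auto
    finally show ?thesis by (simp only: I_real)
  qed
  have SW_nonneg: "0 \<le> SW p \<gamma> \<mu> \<nu>" for \<mu> \<nu> by (simp add: SW_def)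

  have tri: "SW p \<gamma> \<mu> \<rho> \<le> SW p \<gamma> \<mu> \<nu> + SW p \<gamma> \<nu> \<rho>"
    if m: "\<mu> \<in> Pp p" "\<nu> \<in> Pp p" "\<rho> \<in> Pp p" for \<mu> \<nu> \<rho>
  \<comment> \<open>The slack \<open>e / 2\<close> in each summand provides the positive bounds that
    Minkowski's inequality requires.\<close>
  proof (rule field_le_epsilon)
    fix e :: real assume "0 < e"
    define a b where "a = SW p \<gamma> \<mu> \<nu> + e / 2" and "b = SW p \<gamma> \<nu> \<rho> + e / 2"
    have pos: "0 < a" "0 < b"
      using SW_nonneg[of \<mu> \<nu>] SW_nonneg[of \<nu> \<rho>] \<open>0 < e\<close> by (auto simp: a_def b_def intro: add_nonneg_pos)
    have "SW p \<gamma> \<mu> \<nu> \<le> a" "SW p \<gamma> \<nu> \<rho> \<le> b" using \<open>0 < e\<close> by (auto simp: a_def b_def)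
    then have I: "I \<mu> \<nu> \<le> ennreal ((k * a) powr p)" "I \<nu> \<rho> \<le> ennreal ((k * b) powr p)"
      using pos by (auto simp: SW_le_iff[OF m(1,2)] SW_le_iff[OF m(2,3)])
    have "D \<mu> \<rho> \<theta> \<le> D \<mu> \<nu> \<theta> + D \<nu> \<rho> \<theta>" for \<theta>
      unfolding D_def using m by (intro Wp_triangle(2)[OF p] Wp_proj_measure_finite(1)[OF p])
    then have "I \<mu> \<rho> \<le> ennreal ((k * a + k * b) powr p)"
      unfolding I_def
      by (intro Minkowski_nn_integral[OF p _ _ D_meas[OF m(1,2)] D_meas[OF m(2,3)]])
        (use pos k I in \<open>auto simp: D_nonneg I_def\<close>)
    then have "SW p \<gamma> \<mu> \<rho> \<le> a + b"
      using pos by (subst SW_le_iff[OF m(1,3)]) (auto simp: distrib_left)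
    then show "SW p \<gamma> \<mu> \<rho> \<le> SW p \<gamma> \<mu> \<nu> + SW p \<gamma> \<nu> \<rho> + e" by (simp add: a_def b_def)
  qed

  have SW_self: "SW p \<gamma> \<mu> \<mu> = 0" if "\<mu> \<in> Pp p" for \<mu>
  proof -
    have "D \<mu> \<mu> \<theta> = 0" for \<theta>
      using Wp_proj_measure_le(2)[OF p that, of \<theta> \<theta>] by (simp add: D_def order_antisym)
    then have "SW p \<gamma> \<mu> \<mu> \<le> 0" by (subst SW_le_iff[OF that that]) (auto simp: I_def)
    with SW_nonneg[of \<mu> \<mu>] show ?thesis by simp
  qed

  have zero: "\<mu> = \<nu>" if m: "\<mu> \<in> Pp p" "\<nu> \<in> Pp p" and 0: "SW p \<gamma> \<mu> \<nu> = 0" for \<mu> \<nu>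
  proof -
    note [measurable_cong] = PpD(1)[OF m(1)] PpD(1)[OF m(2)]
    note [measurable] = D_meas[OF m]
    have "I \<mu> \<nu> = 0" using SW_le_iff[OF m, of 0] 0 by simp
    then have ae: "AE \<theta> in \<gamma>. D \<mu> \<nu> \<theta> = 0"
      unfolding I_def by (subst (asm) nn_integral_0_iff_AE) (auto simp: D_nonneg)
    \<comment> \<open>Upgrades almost everywhere to everywhere: by continuity the set where
      \<open>D\<close> is nonzero is relatively open, so if nonempty it would have positive
      measure.\<close>
    have D0: "D \<mu> \<nu> \<theta> = 0" if \<theta>: "\<theta> \<in> ?S" for \<theta>
    proof (rule ccontr)
      assume "D \<mu> \<nu> \<theta> \<noteq> 0"
      let ?U = "?S \<inter> D \<mu> \<nu> -` (- {0})"
      have "openin (top_of_set ?S) ?U"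
        by (rule continuous_openin_preimage_gen[OF D_cont[OF m]]) auto
      moreover have "?U \<noteq> {}" using \<open>D \<mu> \<nu> \<theta> \<noteq> 0\<close> \<theta> by auto
      ultimately have "emeasure \<gamma> ?U > 0" by (rule \<gamma>_strict)
      moreover have "{\<theta> \<in> space \<gamma>. \<not> D \<mu> \<nu> \<theta> = 0} = ?U"
        by (auto simp: \<gamma>_space)
      moreover have "emeasure \<gamma> {\<theta> \<in> space \<gamma>. \<not> D \<mu> \<nu> \<theta> = 0} = 0"
        using ae by (subst (asm) AE_iff_measurable[OF _ refl]) auto
      ultimately show False by simp
    qed
    show ?thesis
    proof (rule Cramer_Wold_cos)
      fix t :: 'a and s
      show "(\<integral>x. cos (inner t x + s) \<partial>\<mu>) = (\<integral>x. cos (inner t x + s) \<partial>\<nu>)"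
      \<comment> \<open>The vector 0 has no direction on the sphere, but there both integrands are
        the constant \<open>cos s\<close>.\<close>
      proof (cases "t = 0")
        case True
        interpret \<mu>: prob_space \<mu> using PpD[OF m(1)] by blast
        interpret \<nu>: prob_space \<nu> using PpD[OF m(2)] by blast
        show ?thesis using True by (simp add: \<mu>.prob_space \<nu>.prob_space)
      next
        case False
        \<comment> \<open>The length of \<open>t\<close> moves into the frequency of the
          one-dimensional cosine.\<close>
        define \<theta> where "\<theta> = t /\<^sub>R norm t"
        have \<theta>: "\<theta> \<in> ?S" "inner t x = norm t * inner \<theta> x" for x
          using False by (auto simp: \<theta>_def unit_sphere_def)
        have "Wpp p (proj_measure \<mu> \<theta>) (proj_measure \<nu> \<theta>) = 0"
          using D0[OF \<theta>(1)] by (simp add: Wpp_eq[OF m])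
        from Wpp_eq_0_imp_integral_cos_eq[OF p this, of "norm t" s]
        show ?thesis by (simp add: \<theta>(2) proj_measure_def integral_distr)
      qed
    qed (use PpD m in auto)
  qed

  have sym: "SW p \<gamma> \<mu> \<nu> = SW p \<gamma> \<nu> \<mu>" for \<mu> \<nu>
    by (simp add: SW_def SWpp_def Wpp_commute[of p "proj_measure \<mu> _"])
  show ?thesis
    using fin sym tri SW_self zero by blast
qed

end
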